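(* Let $n,d$ be positive integers with $n\ge2d$. Let $\boldsymbol{X}=\langle X_i:i\in[n]^d\rangle$ be a random tensor and $\boldsymbol{\theta}=\langle\theta_i:i\in[n]^d\rangle$ a deterministic real tensor which satisfy the following. (A1) $\mathbb{E}[X_i]=0$, $\mathbb{E}[X_i^2]\le1$ and $\mathbb{E}[|X_i|^3]<\infty$ for every $i\in[n]^d$. (A2) $\boldsymbol{X}$ is symmetric, exchangeable and its diagonal terms vanish. (A3) $\boldsymbol{\theta}$ is symmetric and its diagonal terms vanish. Then, with $\langle\boldsymbol{\theta},\boldsymbol{X}\rangle:=\sum_{i\in[n]^d}\theta_iX_i$, we have $$\mathrm{Var}\big(\langle\boldsymbol{\theta},\boldsymbol{X}\rangle\big)=\sum_{s=0}^d\binom ds^2s!\,\Big(\sum_{t=0}^s\binom st(-1)^{s-t}\delta_t\Big)\,|||\boldsymbol{\theta}|||_s^2.$$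
   Context: $[n]=\{1,\dots,n\}$; elements $i\in[n]^d$ are viewed as functions $[d]\to[n]$ with $r$-th entry $i(r)$. An index $i\in[n]^d$ is diagonal if its entries are not pairwise distinct; a tensor has vanishing diagonal terms if its entry at every diagonal index is $0$. A tensor indexed by $[n]^d$ is symmetric if its entry at $(i_1,\dots,i_d)$ equals its entry at $(i_{\tau(1)},\dots,i_{\tau(d)})$ for every permutation $\tau$ of $[d]$. A random tensor $\boldsymbol{X}$ is exchangeable if for every permutation $\pi$ of $[n]$ the random tensors $\boldsymbol{X}$ and $\langle X_{\pi\circ i}:i\in[n]^d\rangle$ have the same distribution, where $\pi\circ i=(\pi(i_1),\dots,\pi(i_d))$. Seminorms: $|||\boldsymbol{\theta}|||_0:=\big|\sum_{i\in[n]^d}\theta_i\big|$ and, for $s\in\{1,\dots,d\}$, $|||\boldsymbol{\theta}|||_s:=\Big(\sum_{j\in[n]^s}\big(\sum_{i}\theta_i\big)^2\Big)^{1/2}$, where the inner sum is over all $i\in[n]^d$ with $i(r)=j(r)$ for every $r\in[s]$. For $s\in\{1,\dots,d\}$, $\delta_s:=\mathbb{E}[X_{(1,\dots,d)}X_{(1,\dots,s,d+1,\dots,2d-s)}]$, and $\delta_0:=\mathbb{E}[X_{(1,\dots,d)}X_{(d+1,\dots,2d)}]$. *)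

theory Defs
  imports "HOL-Probability.Probability"
begin

definition indices :: "nat \<Rightarrow> nat \<Rightarrow> (nat \<Rightarrow> nat) set" where
  "indices n d = {1..d} \<rightarrow>\<^sub>E {1..n}"

definition diagonal_index :: "nat \<Rightarrow> (nat \<Rightarrow> nat) \<Rightarrow> bool" where
  "diagonal_index d i \<longleftrightarrow> \<not> inj_on i {1..d}"

definition vanishing_diagonal :: "nat \<Rightarrow> nat \<Rightarrow> ((nat \<Rightarrow> nat) \<Rightarrow> real) \<Rightarrow> bool" where
  "vanishing_diagonal n d \<theta> \<longleftrightarrow> (\<forall>i\<in>indices n d. diagonal_index d i \<longrightarrow> \<theta> i = 0)"

(* If tau permutes {1..d}, then i o tau is again extensional, hence in indices n d. *)
definition symmetric_tensor :: "nat \<Rightarrow> nat \<Rightarrow> ((nat \<Rightarrow> nat) \<Rightarrow> real) \<Rightarrow> bool" where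
  "symmetric_tensor n d \<theta> \<longleftrightarrow>
     (\<forall>i\<in>indices n d. \<forall>\<tau>. \<tau> permutes {1..d} \<longrightarrow> \<theta> (i \<circ> \<tau>) = \<theta> i)"

definition tensor_distr ::
  "'a measure \<Rightarrow> nat \<Rightarrow> nat \<Rightarrow> ((nat \<Rightarrow> nat) \<Rightarrow> 'a \<Rightarrow> real) \<Rightarrow> ((nat \<Rightarrow> nat) \<Rightarrow> real) measure" where
  "tensor_distr M n d X =
     distr M (\<Pi>\<^sub>M i\<in>indices n d. borel) (\<lambda>\<omega>. \<lambda>i\<in>indices n d. X i \<omega>)"

(* compose {1..d} \<pi> i is \<pi> o i, kept extensional so that it lies in indices n d. *)
definition exchangeable_tensor ::
  "'a measure \<Rightarrow> nat \<Rightarrow> nat \<Rightarrow> ((nat \<Rightarrow> nat) \<Rightarrow> 'a \<Rightarrow> real) \<Rightarrow> bool" where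
  "exchangeable_tensor M n d X \<longleftrightarrow>
     (\<forall>\<pi>. \<pi> permutes {1..n} \<longrightarrow>
        tensor_distr M n d X = tensor_distr M n d (\<lambda>i. X (compose {1..d} \<pi> i)))"

definition tensor_seminorm :: "nat \<Rightarrow> nat \<Rightarrow> nat \<Rightarrow> ((nat \<Rightarrow> nat) \<Rightarrow> real) \<Rightarrow> real" where
  "tensor_seminorm n d s \<theta> =
     (if s = 0 then \<bar>\<Sum>i\<in>indices n d. \<theta> i\<bar>
      else sqrt (\<Sum>j\<in>indices n s. (\<Sum>i\<in>{i\<in>indices n d. \<forall>r\<in>{1..s}. i r = j r}. \<theta> i)\<^sup>2))"

(* The index (1,...,s,d+1,...,2d-s); for s = d it is (1,...,d) and for s = 0 it is (d+1,...,2d). *)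
definition overlap_index :: "nat \<Rightarrow> nat \<Rightarrow> nat \<Rightarrow> nat" where
  "overlap_index d s = (\<lambda>r\<in>{1..d}. if r \<le> s then r else d + (r - s))"

definition delta :: "'a measure \<Rightarrow> nat \<Rightarrow> ((nat \<Rightarrow> nat) \<Rightarrow> 'a \<Rightarrow> real) \<Rightarrow> nat \<Rightarrow> real" where
  "delta M d X s =
     prob_space.expectation M (\<lambda>\<omega>. X (\<lambda>r\<in>{1..d}. r) \<omega> * X (overlap_index d s) \<omega>)"

definition tensor_inner ::
  "nat \<Rightarrow> nat \<Rightarrow> ((nat \<Rightarrow> nat) \<Rightarrow> real) \<Rightarrow> ((nat \<Rightarrow> nat) \<Rightarrow> 'a \<Rightarrow> real) \<Rightarrow> 'a \<Rightarrow> real" where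
  "tensor_inner n d \<theta> X = (\<lambda>\<omega>. \<Sum>i\<in>indices n d. \<theta> i * X i \<omega>)"

end

theory Submission
  imports Defs
begin

text \<open>
  For indices \<open>i\<close>, \<open>k\<close> with pairwise distinct entries, symmetry and exchangeability give
  \<open>E[X\<^sub>i X\<^sub>k] = \<delta>\<^sub>m\<close>, where \<open>m\<close> is the number of common entries, so the variance is the sum of
  \<open>\<theta>\<^sub>i \<theta>\<^sub>k \<delta>\<^sub>m\<close> over such pairs. On the other hand \<open>(d choose s)\<^sup>2 s! |||\<theta>|||\<^sub>s\<^sup>2\<close> is the sum of
  \<open>\<theta>\<^sub>i \<theta>\<^sub>k (m choose s)\<close>: by symmetry of \<open>\<theta>\<close>, fixing the first \<open>s\<close> entries to an injective \<open>j\<close>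
  yields the same sum as fixing any \<open>s\<close> positions to \<open>j\<close>, and summing over all
  \<open>s! (d choose s)\<close> choices of positions yields the sum of \<open>\<theta>\<^sub>i\<close> over all \<open>i\<close> containing the
  entries of \<open>j\<close>. Binomial inversion combines the two formulas.
\<close>

section \<open>Extending injections to permutations\<close>

lemma permutes_extend:
  assumes "finite S" and "A \<subseteq> S" and "inj_on f A" and "f ` A \<subseteq> S"
  obtains \<pi> where "\<pi> permutes S" and "\<And>x. x \<in> A \<Longrightarrow> \<pi> x = f x"
proof -
  have fin: "finite A" "finite (f ` A)"
    using assms finite_subset by auto
  have "card (S - A) = card (S - f ` A)"
    using assms fin by (simp add: card_Diff_subset card_image)
  then obtain g where g: "bij_betw g (S - A) (S - f ` A)"
    using finite_same_card_bij[of "S - A" "S - f ` A"] assms(1) by auto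
  define \<pi> where "\<pi> = (\<lambda>x. if x \<in> A then f x else if x \<in> S then g x else x)"
  have "bij_betw \<pi> A (f ` A)"
    using assms(3) by (subst bij_betw_cong[of A \<pi> f]) (auto simp: \<pi>_def bij_betw_def)
  moreover have "bij_betw \<pi> (S - A) (S - f ` A)"
    using g by (subst bij_betw_cong[of "S - A" \<pi> g]) (auto simp: \<pi>_def)
  ultimately have "bij_betw \<pi> (A \<union> (S - A)) (f ` A \<union> (S - f ` A))"
    by (rule bij_betw_combine) blast
  then have "bij_betw \<pi> S S"
    using assms(2,4) by (simp add: Un_absorb1)
  then have "\<pi> permutes S"
    using assms(2) by (intro bij_imp_permutes) (auto simp: \<pi>_def)
  then show thesis
    by (rule that) (simp add: \<pi>_def)
qed

text \<open>Inverting \<open>g\<close> after applying \<open>f\<close> gives an injective self-map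
  of the finite set \<open>A\<close>; extending it from all of \<open>A\<close> only adds the
  identity outside.\<close>

lemma permutes_reindex:
  assumes "finite A" and "inj_on f A" and "inj_on g A" and "f ` A = g ` A"
  obtains \<tau> where "\<tau> permutes A" and "\<And>x. x \<in> A \<Longrightarrow> g (\<tau> x) = f x"
proof -
  let ?h = "\<lambda>x. inv_into A g (f x)"
  have h: "?h x \<in> A" "g (?h x) = f x" if "x \<in> A" for x
  proof -
    have "f x \<in> g ` A"
      using that assms(4) by blast
    then show "?h x \<in> A" "g (?h x) = f x"
      by (rule inv_into_into, rule f_inv_into_f)
  qed
  have "inj_on ?h A"
  proof (rule inj_onI)
    fix x y assume xy: "x \<in> A" "y \<in> A" "?h x = ?h y"
    then have "f x = f y"
      using h(2) by metis
    then show "x = y"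
      using assms(2) xy by (auto dest: inj_onD)
  qed
  moreover have "?h ` A \<subseteq> A"
    using h(1) by blast
  ultimately obtain \<tau> where \<tau>: "\<tau> permutes A" "\<And>x. x \<in> A \<Longrightarrow> \<tau> x = ?h x"
    using permutes_extend[OF assms(1) order_refl] by metis
  show thesis
    using \<tau> h(2) by (intro that[of \<tau>]) simp_all
qed

section \<open>Counting injections and binomial inversion\<close>

lemma prod_diff_eq_fact_choose:
  "prod ((-) n) {0..<k} = fact k * (n choose k)"
proof (induction k)
  case (Suc k)
  have "prod ((-) n) {0..<Suc k} = fact k * ((n choose k) * (n - k))"
    by (simp add: Suc.IH)
  \<comment> \<open>By the two absorption laws, both sides equal
    \<open>n * ((n - 1) choose k)\<close>; for \<open>k > n\<close> everything is 0, in keeping with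
    truncated subtraction.\<close>
  also have "(n choose k) * (n - k) = Suc k * (n choose Suc k)"
    by (metis binomial_absorb_comp binomial_absorption mult.commute)
  finally show ?case
    by (simp add: algebra_simps)
qed simp

lemma card_PiE_inj:
  assumes "finite A" and "finite B"
  shows "card {f \<in> A \<rightarrow>\<^sub>E B. inj_on f A} = fact (card A) * (card B choose card A)"
  using card_inj_on_subset_funcset[OF assms order_refl] prod_diff_eq_fact_choose by simp

text \<open>Orthogonality relation behind binomial inversion: factoring out
  \<open>m choose t\<close> leaves the alternating sum over row \<open>m - t\<close> of Pascal's
  triangle, which vanishes except for row 0.\<close>

lemma sum_choose_mult_alternating:
  assumes "t \<le> m"
  shows "(\<Sum>s = t..m. real (m choose s) * (real (s choose t) * (-1) ^ (s - t))) = of_bool (t = m)"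
proof -
  have "(\<Sum>s = t..m. real (m choose s) * (real (s choose t) * (-1) ^ (s - t)))
      = (\<Sum>s = t..m. real (m choose t) * ((-1) ^ (s - t) * real ((m - t) choose (s - t))))"
  proof (rule sum.cong)
    fix s assume "s \<in> {t..m}"
    then have "(m choose s) * (s choose t) = (m choose t) * ((m - t) choose (s - t))"
      by (intro choose_mult) auto
    then have "real (m choose s) * real (s choose t) = real (m choose t) * real ((m - t) choose (s - t))"
      by (metis of_nat_mult)
    then show "real (m choose s) * (real (s choose t) * (-1) ^ (s - t))
        = real (m choose t) * ((-1) ^ (s - t) * real ((m - t) choose (s - t)))"
      by (simp add: algebra_simps)
  qed simp
  also have "\<dots> = real (m choose t) * (\<Sum>i\<le>m - t. (-1) ^ i * real ((m - t) choose i))"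
    unfolding sum_distrib_left
    by (rule sum.reindex_bij_witness[where i = "\<lambda>i. i + t" and j = "\<lambda>s. s - t"]) (use assms in auto)
  also have "\<dots> = of_bool (t = m)"
    using assms choose_alternating_sum[of "m - t", where 'a = real] by (cases "t = m") auto
  finally show ?thesis .
qed

text \<open>After interchanging the sums, orthogonality leaves only \<open>t = m\<close>. The outer
  sum runs to \<open>d\<close> so that its range does not depend on \<open>m\<close>; its terms with
  \<open>s > m\<close> are 0.\<close>

lemma binomial_inversion:
  fixes f :: "nat \<Rightarrow> real"
  assumes "m \<le> d"
  shows "(\<Sum>s = 0..d. real (m choose s) * (\<Sum>t = 0..s. real (s choose t) * (-1) ^ (s - t) * f t)) = f m"
proof -
  have "(\<Sum>s = 0..d. real (m choose s) * (\<Sum>t = 0..s. real (s choose t) * (-1) ^ (s - t) * f t))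
      = (\<Sum>s = 0..m. real (m choose s) * (\<Sum>t = 0..s. real (s choose t) * (-1) ^ (s - t) * f t))"
    using assms by (intro sum.mono_neutral_right) (auto simp: binomial_eq_0)
  also have "\<dots> = (\<Sum>s = 0..m. \<Sum>t = 0..s. real (m choose s) * (real (s choose t) * (-1) ^ (s - t)) * f t)"
    by (simp add: sum_distrib_left algebra_simps)
  also have "\<dots> = (\<Sum>t = 0..m. \<Sum>s = t..m. real (m choose s) * (real (s choose t) * (-1) ^ (s - t)) * f t)"
    \<comment> \<open>Both double sums run over the triangle \<open>t \<le> s \<le> m\<close>; as
      sums over pairs they differ by swapping coordinates.\<close>
    unfolding sum.Sigma[OF finite_atLeastAtMost ballI[OF finite_atLeastAtMost]]
    by (rule sum.reindex_bij_witness[where i = prod.swap and j = prod.swap]) auto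
  also have "\<dots> = (\<Sum>t = 0..m. of_bool (t = m) * f t)"
    unfolding sum_distrib_right[symmetric]
    by (intro sum.cong refl) (subst sum_choose_mult_alternating, auto)
  also have "\<dots> = f m"
    by (simp add: of_bool_def if_distrib[of "\<lambda>x. x * _"] cong: if_cong)
  finally show ?thesis .
qed

section \<open>Seminorms as sums over pairs of indices\<close>

lemma indices_comp_permutes:
  assumes "i \<in> indices n d" and "\<tau> permutes {1..d}"
  shows "i \<circ> \<tau> \<in> indices n d"
  using assms permutes_in_image[OF assms(2)] permutes_not_in[OF assms(2)]
  by (simp add: indices_def PiE_iff extensional_def)

lemma finite_indices [simp]: "finite (indices n d)"
  by (simp add: indices_def finite_PiE)

text \<open>The case \<open>s = 0\<close> fits the general formula: \<open>indices n 0\<close> has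
  exactly one element and the prefix condition is vacuous, so the right side is the square of the
  total sum.\<close>

lemma tensor_seminorm_power2:
  "(tensor_seminorm n d s \<theta>)\<^sup>2 =
    (\<Sum>j\<in>indices n s. (\<Sum>i\<in>{i\<in>indices n d. \<forall>r\<in>{1..s}. i r = j r}. \<theta> i)\<^sup>2)"
  by (cases "s = 0") (simp_all add: tensor_seminorm_def indices_def sum_nonneg)

text \<open>Common entries count wherever they stand, because symmetric tensors ignore
  positions.\<close>

definition index_overlap :: "nat \<Rightarrow> (nat \<Rightarrow> nat) \<Rightarrow> (nat \<Rightarrow> nat) \<Rightarrow> nat" where
  "index_overlap d i k = card (i ` {1..d} \<inter> k ` {1..d})"

text \<open>Extend \<open>q\<close> to a permutation \<open>\<tau>\<close> of all positions:
  \<open>i \<mapsto> i \<circ> \<tau>\<close> carries one index set onto the other, and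
  \<open>\<theta>\<close> is invariant under it.\<close>

lemma sum_fixed_positions:
  assumes sym: "symmetric_tensor n d \<theta>"
    and s: "s \<le> d" and q: "q \<in> {1..s} \<rightarrow>\<^sub>E {1..d}" "inj_on q {1..s}"
  shows "(\<Sum>i\<in>{i\<in>indices n d. \<forall>r\<in>{1..s}. i (q r) = j r}. \<theta> i)
       = (\<Sum>i\<in>{i\<in>indices n d. \<forall>r\<in>{1..s}. i r = j r}. \<theta> i)"
proof -
  obtain \<tau> where \<tau>: "\<tau> permutes {1..d}" and \<tau>q: "\<And>r. r \<in> {1..s} \<Longrightarrow> \<tau> r = q r"
    using permutes_extend[of "{1..d}" "{1..s}" q] s q by (auto simp: PiE_iff image_subset_iff)
  show ?thesis
  proof (rule sum.reindex_bij_witness[where i = "\<lambda>i. i \<circ> inv \<tau>" and j = "\<lambda>i. i \<circ> \<tau>"])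
    fix i assume "i \<in> {i\<in>indices n d. \<forall>r\<in>{1..s}. i (q r) = j r}"
    then show "i \<circ> \<tau> \<circ> inv \<tau> = i" "i \<circ> \<tau> \<in> {i\<in>indices n d. \<forall>r\<in>{1..s}. i r = j r}"
        "\<theta> (i \<circ> \<tau>) = \<theta> i"
      using \<tau> sym by (auto simp: comp_assoc permutes_inv_o indices_comp_permutes \<tau>q symmetric_tensor_def)
  next
    fix i assume i: "i \<in> {i\<in>indices n d. \<forall>r\<in>{1..s}. i r = j r}"
    show "i \<circ> inv \<tau> \<circ> \<tau> = i"
      using \<tau> by (simp add: comp_assoc permutes_inv_o)
    have "inv \<tau> (q r) = r" if "r \<in> {1..s}" for r
      using \<tau> \<tau>q[OF that] by (metis permutes_inverses(2))
    then show "i \<circ> inv \<tau> \<in> {i\<in>indices n d. \<forall>r\<in>{1..s}. i (q r) = j r}"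
      using i \<tau> by (simp add: indices_comp_permutes permutes_inv)
  qed
qed

text \<open>Injectivity of \<open>i\<close> forces \<open>q r\<close> to be the unique preimage of
  \<open>j r\<close>, so there is at most one such \<open>q\<close>; injectivity of \<open>j\<close>
  makes it injective.\<close>

lemma card_factorizations:
  assumes i: "inj_on i B" and j: "inj_on j A"
  shows "card {q \<in> A \<rightarrow>\<^sub>E B. inj_on q A \<and> (\<forall>r\<in>A. i (q r) = j r)} = of_bool (j ` A \<subseteq> i ` B)"
    (is "card ?Q = _")
proof (cases "j ` A \<subseteq> i ` B")
  case True
  let ?q = "\<lambda>r\<in>A. inv_into B i (j r)"
  have inv_j: "inv_into B i (j r) \<in> B" "i (inv_into B i (j r)) = j r" if "r \<in> A" for r
    using True that by (auto intro!: inv_into_into f_inv_into_f)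
  have "q = ?q" if "q \<in> ?Q" for q
  proof
    fix r show "q r = ?q r"
    proof (cases "r \<in> A")
      case True
      then have "i (q r) = j r" "q r \<in> B"
        using that by auto
      then show ?thesis
        using inv_into_f_f[OF i, of "q r"] True by simp
    next
      case False
      then show ?thesis
        using that by (auto simp: PiE_iff extensional_def)
    qed
  qed
  moreover have "inj_on ?q A"
  proof (rule inj_onI)
    fix x y assume xy: "x \<in> A" "y \<in> A" "?q x = ?q y"
    then have "j x = j y"
      using inv_j(2) by (metis restrict_apply')
    then show "x = y"
      using j xy by (auto dest: inj_onD)
  qed
  then have "?q \<in> ?Q"
    using inv_j by auto
  ultimately have "?Q = {?q}"
    by blast
  then show ?thesis
    using True by simp
next
  case False
  then have "?Q = {}"
    by (force simp: PiE_iff)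
  then have "card ?Q = 0"
    by (simp only: card.empty)
  then show ?thesis
    using False by simp
qed

text \<open>With the condition turned into a factor, sums with different conditions range over one
  common set and can be interchanged.\<close>

lemma sum_vanishing_diagonal:
  assumes "vanishing_diagonal n d \<theta>"
  shows "(\<Sum>i\<in>{i\<in>indices n d. P i}. \<theta> i)
       = (\<Sum>i\<in>{i\<in>indices n d. inj_on i {1..d}}. \<theta> i * of_bool (P i))"
proof -
  have "(\<Sum>i\<in>{i\<in>indices n d. P i}. \<theta> i) = (\<Sum>i\<in>indices n d. \<theta> i * of_bool (P i))"
    by (intro sum.mono_neutral_cong_left) auto
  also have "\<dots> = (\<Sum>i\<in>{i\<in>indices n d. inj_on i {1..d}}. \<theta> i * of_bool (P i))"
    using assms by (intro sum.mono_neutral_right) (auto simp: vanishing_diagonal_def diagonal_index_def)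
  finally show ?thesis .
qed

text \<open>Double counting of pairs \<open>(q, i)\<close>: the factor on the left is the number of
  injective choices \<open>q\<close> of positions, and each injective \<open>i\<close> is compatible
  with one \<open>q\<close> or none.\<close>

lemma sum_fixed_prefix_eq_sum_containing:
  assumes sym: "symmetric_tensor n d \<theta>" and van: "vanishing_diagonal n d \<theta>"
    and s: "s \<le> d" and j: "inj_on j {1..s}"
  shows "fact s * real (d choose s) * (\<Sum>i\<in>{i\<in>indices n d. \<forall>r\<in>{1..s}. i r = j r}. \<theta> i)
       = (\<Sum>i\<in>{i\<in>indices n d. inj_on i {1..d}}. \<theta> i * of_bool (j ` {1..s} \<subseteq> i ` {1..d}))"
    (is "_ * ?F = _")
proof -
  let ?Q = "{q \<in> {1..s} \<rightarrow>\<^sub>E {1..d}. inj_on q {1..s}}"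
  let ?I = "{i\<in>indices n d. inj_on i {1..d}}"
  have fin: "finite ?Q"
    by (simp add: finite_PiE)
  have "fact s * real (d choose s) * ?F = (\<Sum>q\<in>?Q. ?F)"
    by (simp add: card_PiE_inj)
  also have "\<dots> = (\<Sum>q\<in>?Q. \<Sum>i\<in>{i\<in>indices n d. \<forall>r\<in>{1..s}. i (q r) = j r}. \<theta> i)"
    using s by (intro sum.cong refl sum_fixed_positions[OF sym, symmetric]) auto
  also have "\<dots> = (\<Sum>q\<in>?Q. \<Sum>i\<in>?I. \<theta> i * of_bool (\<forall>r\<in>{1..s}. i (q r) = j r))"
    unfolding sum_vanishing_diagonal[OF van] ..
  also have "\<dots> = (\<Sum>i\<in>?I. \<Sum>q\<in>?Q. \<theta> i * of_bool (\<forall>r\<in>{1..s}. i (q r) = j r))"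
    by (rule sum.swap)
  also have "\<dots> = (\<Sum>i\<in>?I. \<theta> i * of_bool (j ` {1..s} \<subseteq> i ` {1..d}))"
  proof (rule sum.cong[OF refl])
    fix i assume "i \<in> ?I"
    then have "card {q \<in> {1..s} \<rightarrow>\<^sub>E {1..d}. inj_on q {1..s} \<and> (\<forall>r\<in>{1..s}. i (q r) = j r)}
        = of_bool (j ` {1..s} \<subseteq> i ` {1..d})"
      using j by (intro card_factorizations) auto
    moreover have "(\<Sum>q\<in>?Q. of_bool (\<forall>r\<in>{1..s}. i (q r) = j r) :: real)
        = real (card {q \<in> {1..s} \<rightarrow>\<^sub>E {1..d}. inj_on q {1..s} \<and> (\<forall>r\<in>{1..s}. i (q r) = j r)})"
      using fin by (subst sum_of_bool_eq) (auto intro!: arg_cong[where f = card])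
    ultimately show "(\<Sum>q\<in>?Q. \<theta> i * of_bool (\<forall>r\<in>{1..s}. i (q r) = j r))
        = \<theta> i * of_bool (j ` {1..s} \<subseteq> i ` {1..d})"
      by (simp flip: sum_distrib_left)
  qed
  finally show ?thesis .
qed

text \<open>Expanding the square of the sum over indices containing the entries of \<open>j\<close>
  gives pairs \<open>i\<close>, \<open>k\<close>; each pair is weighted by the number of injective
  \<open>j\<close> with values among their common entries.\<close>

lemma tensor_seminorm_eq_overlap_sum:
  assumes sym: "symmetric_tensor n d \<theta>" and van: "vanishing_diagonal n d \<theta>" and s: "s \<le> d"
  shows "(real (d choose s))\<^sup>2 * fact s * (tensor_seminorm n d s \<theta>)\<^sup>2
       = (\<Sum>i\<in>{i\<in>indices n d. inj_on i {1..d}}. \<Sum>k\<in>{k\<in>indices n d. inj_on k {1..d}}.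
            \<theta> i * \<theta> k * real (index_overlap d i k choose s))"
proof -
  let ?I = "{i\<in>indices n d. inj_on i {1..d}}"
  let ?J = "{j\<in>indices n s. inj_on j {1..s}}"
  define F where "F j = (\<Sum>i\<in>{i\<in>indices n d. \<forall>r\<in>{1..s}. i r = j r}. \<theta> i)" for j
  define N where "N = fact s * real (d choose s)"
  \<comment> \<open>Every index with a non-injective prefix is diagonal, so the sum over
    \<open>j\<close> may be restricted to \<open>?J\<close>.\<close>
  have F0: "F j = 0" if "\<not> inj_on j {1..s}" for j
    unfolding F_def
  proof (rule sum.neutral, rule ballI)
    fix i assume "i \<in> {i\<in>indices n d. \<forall>r\<in>{1..s}. i r = j r}"
    then have i: "i \<in> indices n d" "\<And>r. r \<in> {1..s} \<Longrightarrow> i r = j r"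
      by auto
    have "inj_on j {1..s}" if "inj_on i {1..d}"
    proof -
      have "inj_on i {1..s}"
        using s by (intro inj_on_subset[OF that]) auto
      then show ?thesis
        using i(2) by (subst (asm) inj_on_cong[of _ i j]) auto
    qed
    then show "\<theta> i = 0"
      using \<open>\<not> inj_on j {1..s}\<close> van i(1) by (auto simp: vanishing_diagonal_def diagonal_index_def)
  qed
  have card: "(\<Sum>j\<in>?J. of_bool (j ` {1..s} \<subseteq> i ` {1..d}) * of_bool (j ` {1..s} \<subseteq> k ` {1..d}) :: real)
      = fact s * real (index_overlap d i k choose s)" if "i \<in> ?I" for i k
  proof -
    have "?J \<inter> {j. j ` {1..s} \<subseteq> i ` {1..d} \<and> j ` {1..s} \<subseteq> k ` {1..d}}
        = {j \<in> {1..s} \<rightarrow>\<^sub>E (i ` {1..d} \<inter> k ` {1..d}). inj_on j {1..s}}"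
    proof -
      \<comment> \<open>The range condition \<open>j \<in> indices n s\<close> is then implied by
        having values among the entries of \<open>i\<close>.\<close>
      have "i ` {1..d} \<subseteq> {1..n}"
        using that by (auto simp: indices_def)
      then show ?thesis
        unfolding indices_def PiE_iff by blast
    qed
    moreover have "(\<Sum>j\<in>?J. of_bool (j ` {1..s} \<subseteq> i ` {1..d}) * of_bool (j ` {1..s} \<subseteq> k ` {1..d}) :: real)
        = real (card (?J \<inter> {j. j ` {1..s} \<subseteq> i ` {1..d} \<and> j ` {1..s} \<subseteq> k ` {1..d}}))"
      by (subst sum_of_bool_eq[symmetric]) (auto simp: of_bool_conj)
    ultimately show ?thesis
      by (simp add: card_PiE_inj index_overlap_def)
  qed
  have "N\<^sup>2 * (tensor_seminorm n d s \<theta>)\<^sup>2 = (\<Sum>j\<in>?J. (N * F j)\<^sup>2)"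
    unfolding tensor_seminorm_power2 F_def[symmetric] sum_distrib_left power_mult_distrib[symmetric]
    by (intro sum.mono_neutral_right) (auto simp: F0)
  also have "\<dots> = (\<Sum>j\<in>?J. (\<Sum>i\<in>?I. \<theta> i * of_bool (j ` {1..s} \<subseteq> i ` {1..d}))\<^sup>2)"
    unfolding N_def F_def
    by (intro sum.cong refl) (subst sum_fixed_prefix_eq_sum_containing[OF sym van s], auto)
  also have "\<dots> = (\<Sum>j\<in>?J. \<Sum>i\<in>?I. \<Sum>k\<in>?I. \<theta> i * \<theta> k *
      (of_bool (j ` {1..s} \<subseteq> i ` {1..d}) * of_bool (j ` {1..s} \<subseteq> k ` {1..d})))"
    unfolding power2_eq_square sum_product by (simp only: mult_ac)
  also have "\<dots> = (\<Sum>i\<in>?I. \<Sum>k\<in>?I. \<Sum>j\<in>?J. \<theta> i * \<theta> k *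
      (of_bool (j ` {1..s} \<subseteq> i ` {1..d}) * of_bool (j ` {1..s} \<subseteq> k ` {1..d})))"
    by (subst sum.swap, intro sum.cong refl sum.swap)
  also have "\<dots> = (\<Sum>i\<in>?I. \<Sum>k\<in>?I. \<theta> i * \<theta> k * (fact s * real (index_overlap d i k choose s)))"
    unfolding sum_distrib_left[symmetric] by (intro sum.cong refl) (simp only: card)
  also have "\<dots> = fact s * (\<Sum>i\<in>?I. \<Sum>k\<in>?I. \<theta> i * \<theta> k * real (index_overlap d i k choose s))"
    by (simp add: sum_distrib_left mult_ac)
  \<comment> \<open>\<open>N\<^sup>2\<close> contains \<open>fact s\<close> twice; one copy cancels
    against the number of orderings of the entries of \<open>j\<close>.\<close>
  finally show ?thesis
    by (simp add: N_def power2_eq_square mult_ac)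
qed

section \<open>Normal form of a pair of injective indices\<close>

lemma overlap_index_in_indices:
  assumes "n \<ge> 2 * d"
  shows "overlap_index d s \<in> indices n d"
  using assms by (auto simp: overlap_index_def indices_def)

lemma compose_in_indices:
  assumes "\<pi> permutes {1..n}" and "i \<in> indices n d"
  shows "compose {1..d} \<pi> i \<in> indices n d"
  using assms permutes_in_image[OF assms(1)] by (simp add: indices_def compose_def PiE_iff)

text \<open>The equality holds for whole functions: outside \<open>{1..d}\<close> both indices are
  \<open>undefined\<close> and \<open>\<tau>\<close> is the identity. This is the form in which
  \<open>symmetric_tensor\<close> applies.\<close>

lemma ex_permutes_reindex:
  assumes i: "i \<in> indices n d" "inj_on i {1..d}"
    and k: "k \<in> indices n d" "inj_on k {1..d}" and eq: "i ` {1..d} = k ` {1..d}"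
  obtains \<tau> where "\<tau> permutes {1..d}" and "k \<circ> \<tau> = i"
proof -
  obtain \<tau> where \<tau>: "\<tau> permutes {1..d}" "\<And>x. x \<in> {1..d} \<Longrightarrow> k (\<tau> x) = i x"
    using permutes_reindex[OF _ i(2) k(2) eq] by auto
  have "(k \<circ> \<tau>) x = i x" for x
  proof (cases "x \<in> {1..d}")
    case True
    then show ?thesis
      using \<tau>(2) by simp
  next
    case False
    then show ?thesis
      using i(1) k(1) permutes_not_in[OF \<tau>(1) False]
      by (simp add: indices_def PiE_iff extensional_def del: atLeastAtMost_iff)
  qed
  then show thesis
    using that \<tau>(1) by blast
qed

text \<open>Three blocks are matched: \<open>{1..m}\<close> with the common entries,
  \<open>{m+1..d}\<close> with those only in \<open>i\<close>, \<open>{d+1..2*d-m}\<close> with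
  those only in \<open>k\<close>. Only sets of entries are matched here, not their order.\<close>

lemma ex_permutes_overlap:
  assumes i: "i \<in> indices n d" "inj_on i {1..d}" and k: "k \<in> indices n d" "inj_on k {1..d}"
  defines "m \<equiv> index_overlap d i k"
  obtains \<pi> where "\<pi> permutes {1..n}" and "\<pi> ` {1..d} = i ` {1..d}"
    and "\<pi> ` overlap_index d m ` {1..d} = k ` {1..d}"
    and "inj_on (overlap_index d m) {1..d}"
proof -
  define I K where "I = i ` {1..d}" and "K = k ` {1..d}"
  have card: "card I = d" "card K = d" "finite I" "finite K"
    using i(2) k(2) by (simp_all add: I_def K_def card_image)
  have m: "m = card (I \<inter> K)"
    by (simp add: m_def index_overlap_def I_def K_def)
  then have "m \<le> d"
    using card by (metis Int_lower1 card_mono)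
  have IK: "card (I - K) = d - m" "card (K - I) = d - m" "card (I \<union> K) = 2 * d - m"
    using card m card_Un_Int[of I K] by (simp_all add: card_Diff_subset_Int Int_commute)
  have sub: "I \<union> K \<subseteq> {1..n}"
    using i(1) k(1) by (auto simp: I_def K_def indices_def)
  then have n: "2 * d - m \<le> n"
    using card_mono[OF _ sub] IK(3) by simp
  obtain a where a: "bij_betw a {1..m} (I \<inter> K)"
    using finite_same_card_bij[of "{1..m}" "I \<inter> K"] card m by auto
  obtain b where b: "bij_betw b {m+1..d} (I - K)"
    using finite_same_card_bij[of "{m+1..d}" "I - K"] card IK by auto
  obtain c where c: "bij_betw c {d+1..2*d-m} (K - I)"
    using finite_same_card_bij[of "{d+1..2*d-m}" "K - I"] card IK by auto
  define p where "p x = (if x \<le> m then a x else if x \<le> d then b x else c x)" for x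
  have pa: "bij_betw p {1..m} (I \<inter> K)"
    using a by (subst bij_betw_cong[of _ p a]) (auto simp: p_def)
  have pb: "bij_betw p {m+1..d} (I - K)"
    using b by (subst bij_betw_cong[of _ p b]) (auto simp: p_def)
  have pc: "bij_betw p {d+1..2*d-m} (K - I)"
    using c \<open>m \<le> d\<close> by (subst bij_betw_cong[of _ p c]) (auto simp: p_def)
  have "bij_betw p ({1..m} \<union> {m+1..d}) (I \<inter> K \<union> (I - K))"
    by (rule bij_betw_combine[OF pa pb]) blast
  moreover have "{1..m} \<union> {m+1..d} = {1..d}"
    using \<open>m \<le> d\<close> by auto
  ultimately have pI: "bij_betw p {1..d} I"
    by (simp add: Int_Diff_Un)
  have "bij_betw p ({1..d} \<union> {d+1..2*d-m}) (I \<union> (K - I))"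
    by (rule bij_betw_combine[OF pI pc]) blast
  moreover have U: "{1..d} \<union> {d+1..2*d-m} = {1..2*d-m}"
    using \<open>m \<le> d\<close> by auto
  ultimately have p: "bij_betw p {1..2*d-m} (I \<union> K)"
    by simp
  have "p ` {1..2*d-m} \<subseteq> {1..n}"
    using p sub by (simp only: bij_betw_def)
  moreover have "{1..2*d-m} \<subseteq> {1..n}"
    using n by auto
  ultimately obtain \<pi> where \<pi>: "\<pi> permutes {1..n}" "\<And>x. x \<in> {1..2*d-m} \<Longrightarrow> \<pi> x = p x"
    using p permutes_extend[of "{1..n}" "{1..2*d-m}" p] by (metis bij_betw_def finite_atLeastAtMost)
  have "\<pi> ` {1..d} = p ` {1..d}"
    using U by (intro image_cong refl \<pi>(2)) blast
  then have 1: "\<pi> ` {1..d} = I"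
    using pI by (simp add: bij_betw_def)
  have O: "overlap_index d m ` {1..d} = {1..m} \<union> {d+1..2*d-m}"
  proof (intro equalityI subsetI)
    fix x assume x: "x \<in> {1..m} \<union> {d+1..2*d-m}"
    \<comment> \<open>For \<open>x > d\<close> the witness solves \<open>d + (r - m) = x\<close> for
      \<open>r\<close>.\<close>
    show "x \<in> overlap_index d m ` {1..d}"
      using x \<open>m \<le> d\<close>
      by (intro image_eqI[of _ _ "if x \<le> m then x else x - d + m"]) (auto simp: overlap_index_def)
  qed (use \<open>m \<le> d\<close> in \<open>auto simp: overlap_index_def split: if_splits\<close>)
  have "\<pi> ` overlap_index d m ` {1..d} = p ` ({1..m} \<union> {d+1..2*d-m})"
    unfolding O using \<open>m \<le> d\<close> by (intro image_cong refl \<pi>(2)) auto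
  also have "\<dots> = K"
    unfolding image_Un using pa pc by (auto simp: bij_betw_def)
  finally have 2: "\<pi> ` overlap_index d m ` {1..d} = K" .
  have "inj_on (overlap_index d m) {1..d}"
    using \<open>m \<le> d\<close> by (auto simp: inj_on_def overlap_index_def split: if_splits)
  then show thesis
    using that \<pi>(1) 1 2 by (simp add: I_def K_def)
qed

text \<open>One \<open>\<pi>\<close> acts on the values of both model indices at once;
  \<open>\<sigma>\<close> and \<open>\<tau>\<close> then correct the order of positions separately,
  which suffices since symmetry applies to each entry of the tensor on its own.\<close>

lemma index_pair_normal_form:
  assumes n: "n \<ge> 2 * d"
    and i: "i \<in> indices n d" "inj_on i {1..d}" and k: "k \<in> indices n d" "inj_on k {1..d}"
  obtains \<pi> \<sigma> \<tau> where "\<pi> permutes {1..n}" and "\<sigma> permutes {1..d}" and "\<tau> permutes {1..d}"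
    and "compose {1..d} \<pi> (\<lambda>r\<in>{1..d}. r) \<circ> \<sigma> = i"
    and "compose {1..d} \<pi> (overlap_index d (index_overlap d i k)) \<circ> \<tau> = k"
proof -
  let ?o = "overlap_index d (index_overlap d i k)" and ?id = "\<lambda>r\<in>{1..d}. r"
  obtain \<pi> where \<pi>: "\<pi> permutes {1..n}" "\<pi> ` {1..d} = i ` {1..d}"
      "\<pi> ` ?o ` {1..d} = k ` {1..d}" "inj_on ?o {1..d}"
    using ex_permutes_overlap[OF i k] .
  have inj: "inj_on (compose {1..d} \<pi> f) {1..d}" if "inj_on f {1..d}" for f
    using comp_inj_on[OF that inj_on_subset[OF permutes_inj[OF \<pi>(1)] subset_UNIV]]
    by (subst inj_on_cong[of _ _ "\<pi> \<circ> f"]) (simp_all add: compose_def)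
  have image: "compose {1..d} \<pi> f ` {1..d} = \<pi> ` f ` {1..d}" for f
    by (auto simp: compose_def image_image)
  have id: "?id \<in> indices n d" and inj_id: "inj_on ?id {1..d}"
    using n by (auto simp: indices_def inj_on_def)
  have "i ` {1..d} = compose {1..d} \<pi> ?id ` {1..d}"
    unfolding image \<pi>(2)[symmetric] by simp
  then obtain \<sigma> where \<sigma>: "\<sigma> permutes {1..d}" "compose {1..d} \<pi> ?id \<circ> \<sigma> = i"
    by (rule ex_permutes_reindex[OF i compose_in_indices[OF \<pi>(1) id] inj[OF inj_id]])
  have "k ` {1..d} = compose {1..d} \<pi> ?o ` {1..d}"
    unfolding image \<pi>(3) ..
  then obtain \<tau> where \<tau>: "\<tau> permutes {1..d}" "compose {1..d} \<pi> ?o \<circ> \<tau> = k"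
    by (rule ex_permutes_reindex[OF k compose_in_indices[OF \<pi>(1) overlap_index_in_indices[OF n]]
          inj[OF \<pi>(4)]])
  show thesis
    using that \<pi>(1) \<sigma> \<tau> by blast
qed

section \<open>Mixed moments of the random tensor\<close>

text \<open>A product of two entries is a function of the whole tensor, so its expectation is an
  integral against \<open>tensor_distr\<close>, which exchangeability preserves.\<close>

lemma exchangeable_expectation_mult:
  fixes X :: "(nat \<Rightarrow> nat) \<Rightarrow> 'a \<Rightarrow> real"
  assumes meas: "\<And>i. i \<in> indices n d \<Longrightarrow> X i \<in> borel_measurable M"
    and exch: "exchangeable_tensor M n d X" and \<pi>: "\<pi> permutes {1..n}"
    and a: "a \<in> indices n d" and b: "b \<in> indices n d"
  shows "(\<integral>\<omega>. X (compose {1..d} \<pi> a) \<omega> * X (compose {1..d} \<pi> b) \<omega> \<partial>M) = (\<integral>\<omega>. X a \<omega> * X b \<omega> \<partial>M)"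
proof -
  have E: "(\<integral>f. f a * f b \<partial>tensor_distr M n d Y) = (\<integral>\<omega>. Y a \<omega> * Y b \<omega> \<partial>M)"
    if "\<And>i. i \<in> indices n d \<Longrightarrow> Y i \<in> borel_measurable M" for Y :: "(nat \<Rightarrow> nat) \<Rightarrow> 'a \<Rightarrow> real"
    unfolding tensor_distr_def
    by (subst integral_distr)
      (use that a b in \<open>auto intro!: measurable_restrict borel_measurable_times measurable_component_singleton\<close>)
  let ?Y = "\<lambda>i. X (compose {1..d} \<pi> i)"
  have "(\<integral>\<omega>. ?Y a \<omega> * ?Y b \<omega> \<partial>M) = (\<integral>f. f a * f b \<partial>tensor_distr M n d ?Y)"
    by (rule E[symmetric]) (intro meas compose_in_indices[OF \<pi>])
  also have "tensor_distr M n d ?Y = tensor_distr M n d X"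
    using exch[unfolded exchangeable_tensor_def, rule_format, OF \<pi>] by (rule sym)
  also have "(\<integral>f. f a * f b \<partial>tensor_distr M n d X) = (\<integral>\<omega>. X a \<omega> * X b \<omega> \<partial>M)"
    by (rule E[OF meas])
  finally show ?thesis .
qed

text \<open>In the normal form of the pair, symmetry removes \<open>\<sigma>\<close> and
  \<open>\<tau>\<close>, and then exchangeability removes \<open>\<pi>\<close>.\<close>

lemma expectation_mult_eq_delta:
  fixes X :: "(nat \<Rightarrow> nat) \<Rightarrow> 'a \<Rightarrow> real"
  assumes n: "n \<ge> 2 * d"
    and meas: "\<And>i. i \<in> indices n d \<Longrightarrow> X i \<in> borel_measurable M"
    and sym: "AE \<omega> in M. symmetric_tensor n d (\<lambda>i. X i \<omega>)"
    and exch: "exchangeable_tensor M n d X"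
    and i: "i \<in> indices n d" "inj_on i {1..d}" and k: "k \<in> indices n d" "inj_on k {1..d}"
  shows "(\<integral>\<omega>. X i \<omega> * X k \<omega> \<partial>M) = delta M d X (index_overlap d i k)"
proof -
  let ?o = "overlap_index d (index_overlap d i k)" and ?id = "\<lambda>r\<in>{1..d}. r"
  obtain \<pi> \<sigma> \<tau> where \<pi>: "\<pi> permutes {1..n}" and \<sigma>: "\<sigma> permutes {1..d}" and \<tau>: "\<tau> permutes {1..d}"
    and ieq: "compose {1..d} \<pi> ?id \<circ> \<sigma> = i" and keq: "compose {1..d} \<pi> ?o \<circ> \<tau> = k"
    using index_pair_normal_form[OF n i k] .
  have id: "?id \<in> indices n d" and o: "?o \<in> indices n d"
    using n overlap_index_in_indices[OF n] by (auto simp: indices_def)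
  note c = compose_in_indices[OF \<pi> id] compose_in_indices[OF \<pi> o]
  \<comment> \<open>Symmetry of \<open>X\<close> is pointwise but only almost sure, whereas
    exchangeability concerns laws and enters only under the integral.\<close>
  have "AE \<omega> in M. X i \<omega> * X k \<omega> = X (compose {1..d} \<pi> ?id) \<omega> * X (compose {1..d} \<pi> ?o) \<omega>"
    using sym
  proof eventually_elim
    case (elim \<omega>)
    then have "X (compose {1..d} \<pi> ?id \<circ> \<sigma>) \<omega> = X (compose {1..d} \<pi> ?id) \<omega>"
        "X (compose {1..d} \<pi> ?o \<circ> \<tau>) \<omega> = X (compose {1..d} \<pi> ?o) \<omega>"
      using c \<sigma> \<tau> by (simp_all only: symmetric_tensor_def)
    then show ?case
      by (simp only: ieq keq)
  qed
  then have "(\<integral>\<omega>. X i \<omega> * X k \<omega> \<partial>M)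
      = (\<integral>\<omega>. X (compose {1..d} \<pi> ?id) \<omega> * X (compose {1..d} \<pi> ?o) \<omega> \<partial>M)"
    using c i(1) k(1) meas by (intro integral_cong_AE borel_measurable_times) auto
  also have "\<dots> = (\<integral>\<omega>. X ?id \<omega> * X ?o \<omega> \<partial>M)"
    using exchangeable_expectation_mult[OF meas exch \<pi> id o] .
  finally show ?thesis
    by (simp add: delta_def)
qed

section \<open>Integrability and the variance\<close>

text \<open>Domination: \<open>2 * \<bar>x * y\<bar> \<le> x\<^sup>2 + y\<^sup>2\<close> and
  \<open>x\<^sup>2 \<le> 1 + \<bar>x\<bar> ^ 3\<close>, with constants integrable on a finite
  measure space.\<close>

lemma (in finite_measure) integrable_mult_of_cube:
  fixes f g :: "'a \<Rightarrow> real"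
  assumes [measurable]: "f \<in> borel_measurable M" "g \<in> borel_measurable M"
    and "integrable M (\<lambda>\<omega>. \<bar>f \<omega>\<bar> ^ 3)" and "integrable M (\<lambda>\<omega>. \<bar>g \<omega>\<bar> ^ 3)"
  shows "integrable M (\<lambda>\<omega>. f \<omega> * g \<omega>)"
proof (rule Bochner_Integration.integrable_bound)
  show "integrable M (\<lambda>\<omega>. 2 + \<bar>f \<omega>\<bar> ^ 3 + \<bar>g \<omega>\<bar> ^ 3)"
    using assms by simp
  have square_le: "x\<^sup>2 \<le> 1 + \<bar>x\<bar> ^ 3" for x :: real
  proof (cases "\<bar>x\<bar> \<le> 1")
    case True
    then have "x\<^sup>2 \<le> 1"
      by (simp add: abs_square_le_1)
    then show ?thesis
      using zero_le_power[OF abs_ge_zero, of x 3] by linarith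
  next
    case False
    then have "\<bar>x\<bar>\<^sup>2 \<le> \<bar>x\<bar> ^ 3"
      by (intro power_increasing) auto
    then show ?thesis
      by simp
  qed
  have "\<bar>x * y\<bar> \<le> 2 + \<bar>x\<bar> ^ 3 + \<bar>y\<bar> ^ 3" for x y :: real
  proof -
    have "2 * \<bar>x * y\<bar> \<le> x\<^sup>2 + y\<^sup>2"
      using sum_squares_bound[of "\<bar>x\<bar>" "\<bar>y\<bar>"] by (simp add: abs_mult)
    then show ?thesis
      using square_le[of x] square_le[of y] by linarith
  qed
  then show "AE \<omega> in M. norm (f \<omega> * g \<omega>) \<le> norm (2 + \<bar>f \<omega>\<bar> ^ 3 + \<bar>g \<omega>\<bar> ^ 3)"
    by (intro AE_I2) (simp add: abs_of_nonneg)
qed simp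

theorem proposition1p2:
  fixes n d :: nat
    and M :: "'a measure"
    and X :: "(nat \<Rightarrow> nat) \<Rightarrow> 'a \<Rightarrow> real"
    and \<theta> :: "(nat \<Rightarrow> nat) \<Rightarrow> real"
  assumes "n \<ge> 1" and "d \<ge> 1" and "n \<ge> 2 * d"
    and "prob_space M"
    and "\<And>i. i \<in> indices n d \<Longrightarrow> X i \<in> borel_measurable M"
    and "\<And>i. i \<in> indices n d \<Longrightarrow> prob_space.expectation M (X i) = 0"
    and "\<And>i. i \<in> indices n d \<Longrightarrow> prob_space.expectation M (\<lambda>\<omega>. (X i \<omega>)\<^sup>2) \<le> 1"
    and "\<And>i. i \<in> indices n d \<Longrightarrow> integrable M (\<lambda>\<omega>. \<bar>X i \<omega>\<bar> ^ 3)"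
    and "AE \<omega> in M. symmetric_tensor n d (\<lambda>i. X i \<omega>)"
    and "exchangeable_tensor M n d X"
    and "AE \<omega> in M. vanishing_diagonal n d (\<lambda>i. X i \<omega>)"
    and "symmetric_tensor n d \<theta>"
    and "vanishing_diagonal n d \<theta>"
  shows "prob_space.variance M (tensor_inner n d \<theta> X) =
    (\<Sum>s = 0..d. (real (d choose s))\<^sup>2 * fact s *
       (\<Sum>t = 0..s. real (s choose t) * (-1) ^ (s - t) * delta M d X t) *
       (tensor_seminorm n d s \<theta>)\<^sup>2)"
proof -
  interpret prob_space M by fact
  note meas = assms(5)
  define D where "D s = (\<Sum>t = 0..s. real (s choose t) * (-1) ^ (s - t) * delta M d X t)" for s
  let ?I = "{i\<in>indices n d. inj_on i {1..d}}"
  \<comment> \<open>The second factor is taken to be the constant 1.\<close>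
  have int1: "integrable M (X i)" if "i \<in> indices n d" for i
    using integrable_mult_of_cube[of "X i" "\<lambda>_. 1"] meas assms(8) that by simp
  have int2: "integrable M (\<lambda>\<omega>. X i \<omega> * X k \<omega>)" if "i \<in> indices n d" "k \<in> indices n d" for i k
    using that meas assms(8) by (intro integrable_mult_of_cube) auto
  have "expectation (tensor_inner n d \<theta> X) = 0"
    unfolding tensor_inner_def
    by (subst Bochner_Integration.integral_sum) (simp_all add: int1 assms(6))
  then have "variance (tensor_inner n d \<theta> X) = expectation (\<lambda>\<omega>. (tensor_inner n d \<theta> X \<omega>)\<^sup>2)"
    by simp
  also have "\<dots> = expectation (\<lambda>\<omega>. \<Sum>i\<in>indices n d. \<Sum>k\<in>indices n d. \<theta> i * \<theta> k * (X i \<omega> * X k \<omega>))"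
    unfolding tensor_inner_def power2_eq_square sum_product by (simp only: mult_ac)
  also have "\<dots> = (\<Sum>i\<in>indices n d. \<Sum>k\<in>indices n d. \<theta> i * \<theta> k * expectation (\<lambda>\<omega>. X i \<omega> * X k \<omega>))"
    by (simp add: int2 Bochner_Integration.integral_sum)
  \<comment> \<open>Since \<open>\<theta>\<close> vanishes at diagonal indices, first
    \<open>i\<close> and then \<open>k\<close> can be restricted to injective indices, where the
    mixed moments are known.\<close>
  also have "\<dots> = (\<Sum>i\<in>?I. \<Sum>k\<in>indices n d. \<theta> i * \<theta> k * expectation (\<lambda>\<omega>. X i \<omega> * X k \<omega>))"
    using assms(13)
    by (intro sum.mono_neutral_right) (auto simp: vanishing_diagonal_def diagonal_index_def)
  also have "\<dots> = (\<Sum>i\<in>?I. \<Sum>k\<in>?I. \<theta> i * \<theta> k * expectation (\<lambda>\<omega>. X i \<omega> * X k \<omega>))"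
    using assms(13)
    by (intro sum.cong refl sum.mono_neutral_right) (auto simp: vanishing_diagonal_def diagonal_index_def)
  also have "\<dots> = (\<Sum>i\<in>?I. \<Sum>k\<in>?I. \<theta> i * \<theta> k * delta M d X (index_overlap d i k))"
    by (intro sum.cong refl) (subst expectation_mult_eq_delta[OF assms(3) meas assms(9,10)], auto)
  \<comment> \<open>Inversion makes the dependence on the pair purely binomial, matching the weights
    in the seminorm formula; it applies because the overlap is at most \<open>d\<close>.\<close>
  also have "\<dots> = (\<Sum>i\<in>?I. \<Sum>k\<in>?I. \<theta> i * \<theta> k * (\<Sum>s = 0..d. real (index_overlap d i k choose s) * D s))"
  proof (intro sum.cong refl)
    fix i k
    have "index_overlap d i k \<le> card (i ` {1..d})"
      unfolding index_overlap_def by (intro card_mono) auto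
    also have "\<dots> \<le> d"
      using card_image_le[of "{1..d}" i] by simp
    finally show "\<theta> i * \<theta> k * delta M d X (index_overlap d i k)
        = \<theta> i * \<theta> k * (\<Sum>s = 0..d. real (index_overlap d i k choose s) * D s)"
      by (simp only: D_def binomial_inversion)
  qed
  also have "\<dots> = (\<Sum>i\<in>?I. \<Sum>k\<in>?I. \<Sum>s = 0..d. D s * (\<theta> i * \<theta> k * real (index_overlap d i k choose s)))"
    by (simp only: sum_distrib_left mult_ac)
  also have "\<dots> = (\<Sum>s = 0..d. \<Sum>i\<in>?I. \<Sum>k\<in>?I. D s * (\<theta> i * \<theta> k * real (index_overlap d i k choose s)))"
    \<comment> \<open>The sum over \<open>s\<close> moves first past \<open>k\<close>, then past
      \<open>i\<close>.\<close>
    by (subst sum.swap[where B = "{0..d}"]) (subst sum.swap[where B = "{0..d}"], rule refl)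
  also have "\<dots> = (\<Sum>s = 0..d. D s * ((real (d choose s))\<^sup>2 * fact s * (tensor_seminorm n d s \<theta>)\<^sup>2))"
    unfolding sum_distrib_left[symmetric]
    by (intro sum.cong refl) (subst tensor_seminorm_eq_overlap_sum[OF assms(12,13)], auto)
  finally show ?thesis
    by (simp add: D_def mult_ac)
qed

end
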